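(* For every integer $n\ge 0$, $$ H_n (x) = (-1)^n \prod_{i=1}^n \frac{ (6i-3)!\,(3i+2)!\,(2i-1)!} {(4i-1)!\,(4i+1)!\,(3i-2)!} \;\sum_{i=0}^n\frac{n!\,(3n+i+2)!\, 2^i(x-3)^i} {(3n+2)!\, (n-i)!\, (2i+1)!}. $$
   Context: For $k\ge 0$ let $a_k(x)=\sum_{m=0}^{k}\binom{3k+1-m}{k-m}x^m$, and for $n\ge 0$ let $H_n(x)=\det[a_{i+j}(x)]_{0\le i,j\le n}$ be the $(n+1)\times(n+1)$ Hankel determinant. Empty products equal $1$. *)

theory Defs
  imports Complex_Main "Jordan_Normal_Form.Determinant"
begin

text \<open>
  The variable \<open>x\<close> ranges over an arbitrary field of characteristic zero. Such a field is
  infinite, so an identity of polynomial expressions holding for all \<open>x\<close> is the same as the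
  identity of polynomials in an indeterminate. All natural-number subtractions below are exact.
\<close>

definition a_poly :: "nat \<Rightarrow> 'a::field_char_0 \<Rightarrow> 'a" where
  "a_poly k x = (\<Sum>m = 0..k. of_nat ((3 * k + 1 - m) choose (k - m)) * x ^ m)"

definition H :: "nat \<Rightarrow> 'a::field_char_0 \<Rightarrow> 'a" where
  "H n x = det (mat (n + 1) (n + 1) (\<lambda>(i, j). a_poly (i + j) x))"

end

theory Submission
  imports Defs "HOL-Computational_Algebra.Polynomial_FPS"
begin

text \<open>
  Put \<open>u = x - 1\<close>. Re-expanding the entries about \<open>x = 1\<close> gives
  \<open>a\<^sub>k(x) = [s\<^sup>k] (1 + s)\<^sup>3\<^sup>k\<^sup>+\<^sup>2 / (1 - u s)\<close>, so with \<open>w = (1 + s)\<^sup>3 / s\<close> the Hankel form of the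
  sequence is a residue pairing on polynomials in \<open>w\<close> (\<open>a_poly_eq_fps_nth\<close>). Write
  \<open>\<kappa>(s) = (1 - 2 s) (1 - u s)\<close>. If polynomials \<open>P\<close>, \<open>Q\<close> of degrees at most \<open>n\<close>, \<open>n - 1\<close>
  and \<open>R\<close> of degree at most \<open>n\<close> satisfy the Pade relation
  \<open>s P(w) - \<kappa>(s) Q(w) = s\<^sup>n\<^sup>+\<^sup>1 R(s)\<close>, then the coefficient vector of \<open>P\<close> is mapped by the Hankel
  matrix to \<open>R(0)\<close> times the last unit vector (\<open>hankel_apply_of_identity\<close>). Moreover \<open>P\<close> and
  \<open>R\<close> have the same coefficient at index \<open>n\<close>, so Cramer's rule yields
  \<open>coeff R n \<cdot> H\<^sub>n = R(0) \<cdot> H\<^sub>n\<^sub>-\<^sub>1\<close> (\<open>hankel_step_of_R\<close>).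

  Since \<open>s\<close> is cubic over the field of rational functions in \<open>w\<close>, every power of \<open>s\<close> is a
  combination of \<open>s\<close>, \<open>\<kappa>(s)\<close> and \<open>s\<^sup>2\<close> with coefficients polynomial in \<open>w\<close>
  (\<open>power_reduction\<close>). Hence \<open>R\<close> belongs to a Pade relation as soon as the \<open>s\<^sup>2\<close>-component of
  \<open>s\<^sup>n\<^sup>+\<^sup>1 R(s)\<close> vanishes. That component has binomial coefficients, and its vanishing is a
  condition on \<open>T(s) = (s + 2 u) R(s)\<close> which does not involve \<open>u\<close> any more:
  \<open>\<Sum>\<^sub>i (-1)\<^sup>i t\<^sub>i C(n + i + j, 3 j + 2) = 0\<close> for all \<open>j\<close> (\<open>redT_combination_zero\<close>).

  Two polynomials meeting this condition are \<open>s J\<^sub>n(s)\<close> and \<open>J\<^sub>n\<^sub>-\<^sub>1(s)\<close>, where \<open>J\<^sub>n\<close> is the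
  (Jacobi) polynomial for which the sum in the theorem is \<open>J\<^sub>n(-2 u)\<close>. This is the identity
  \<open>jac_moment_zero\<close>: the differential equation of \<open>J\<^sub>n\<close> gives a first-order recurrence in \<open>j\<close>
  for the sums in question, and these are trivially zero for \<open>j \<ge> n\<close>. Taking for \<open>T\<close> the
  combination of the two that vanishes at \<open>s = -2 u\<close> gives
  \<open>J\<^sub>n\<^sub>-\<^sub>1(-2 u) lc(J\<^sub>n) H\<^sub>n = J\<^sub>n(-2 u) J\<^sub>n\<^sub>-\<^sub>1(0) H\<^sub>n\<^sub>-\<^sub>1\<close> (\<open>hankel_step\<close>). As all this is polynomial
  in \<open>x\<close>, it follows that \<open>H\<^sub>n\<close> is \<open>J\<^sub>n(-2 u)\<close> times the product of the numbers
  \<open>J\<^sub>i\<^sub>-\<^sub>1(0) / lc(J\<^sub>i)\<close> (\<open>H_eq_jac\<close>), which are evaluated in closed form (\<open>jac_ratio\<close>).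
\<close>

section \<open>The entries as power series coefficients\<close>

text \<open>
  Both sides satisfy \<open>F N k = C(N, k) + x F (N - 1) (k - 1)\<close>.
\<close>

lemma sum_binomial_recentre:
  fixes x :: "'a::comm_ring_1"
  assumes "k \<le> N"
  shows "(\<Sum>m\<le>k. of_nat ((N - m) choose (k - m)) * x ^ m)
       = (\<Sum>m\<le>k. (x - 1) ^ m * of_nat (Suc N choose (k - m)))"
  using assms
proof (induction k arbitrary: N)
  case 0
  then show ?case by simp
next
  case (Suc k)
  obtain N' where N: "N = Suc N'" using Suc.prems by (cases N) auto
  have IH: "(\<Sum>m\<le>k. of_nat ((N' - m) choose (k - m)) * x ^ m)
      = (\<Sum>m\<le>k. (x - 1) ^ m * of_nat (N choose (k - m)))" (is "?L = ?S")
    using Suc.IH[of N'] Suc.prems N by simp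
  have 1: "(\<Sum>m\<le>Suc k. of_nat ((N - m) choose (Suc k - m)) * x ^ m)
      = of_nat (N choose Suc k) + x * ?L"
    unfolding sum.atMost_Suc_shift N by (simp add: sum_distrib_left mult_ac)
  have "(\<Sum>m\<le>Suc k. (x - 1) ^ m * of_nat (Suc N choose (Suc k - m)))
     = (x - 1) ^ Suc k + (\<Sum>m\<le>k. (x - 1) ^ m * of_nat (Suc N choose Suc (k - m)))"
    by (simp add: Suc_diff_le)
  also have "\<dots> = (x - 1) ^ Suc k + (\<Sum>m\<le>k. (x - 1) ^ m * of_nat (N choose Suc (k - m))) + ?S"
    by (simp add: sum.distrib ring_distribs)
  also have "(x - 1) ^ Suc k + (\<Sum>m\<le>k. (x - 1) ^ m * of_nat (N choose Suc (k - m)))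
     = (\<Sum>m\<le>Suc k. (x - 1) ^ m * of_nat (N choose (Suc k - m)))"
    by (simp add: Suc_diff_le)
  also have "\<dots> = of_nat (N choose Suc k) + (x - 1) * ?S"
    unfolding sum.atMost_Suc_shift by (simp add: sum_distrib_left mult_ac)
  finally show ?case unfolding 1 IH by (simp add: algebra_simps)
qed

text \<open>
  The power series of \<open>1 / (1 - u s)\<close>, given by its coefficients.
\<close>

definition geom_fps :: "'a::comm_ring_1 \<Rightarrow> 'a fps" where
  "geom_fps u = Abs_fps (\<lambda>m. u ^ m)"

lemma one_minus_times_geom_fps:
  "(1 - fps_const u * fps_X) * geom_fps (u :: 'a::comm_ring_1) = 1"
proof (rule fps_ext)
  fix m show "fps_nth ((1 - fps_const u * fps_X) * geom_fps u) m = fps_nth 1 m"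
    by (cases m) (simp_all add: geom_fps_def ring_distribs mult.assoc)
qed

lemma one_plus_fps_X_power_nth:
  "fps_nth ((1 + fps_X :: 'a::comm_ring_1 fps) ^ N) k = of_nat (N choose k)"
proof (induction N arbitrary: k)
  case 0 then show ?case by (cases k) auto
next
  case (Suc N) then show ?case by (cases k) (auto simp: ring_distribs)
qed

lemma a_poly_eq_fps_nth:
  fixes x :: "'a::field_char_0"
  shows "a_poly k x = fps_nth ((1 + fps_X) ^ (3 * k + 2) * geom_fps (x - 1)) k"
proof -
  have "a_poly k x = (\<Sum>m\<le>k. (x - 1) ^ m * of_nat ((3 * k + 2) choose (k - m)))"
    unfolding a_poly_def using sum_binomial_recentre[of k "3*k+1" x]
    by (simp add: atLeast0AtMost)
  also have "\<dots> = fps_nth (geom_fps (x - 1) * (1 + fps_X) ^ (3 * k + 2)) k"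
    by (simp only: fps_mult_nth one_plus_fps_X_power_nth geom_fps_def fps_nth_Abs_fps atLeast0AtMost)
  finally show ?thesis by (simp only: mult.commute)
qed

text \<open>
  The coefficient of \<open>s\<^sup>k\<^sup>+\<^sup>1\<close> in \<open>(1 - 2 s) (1 + s)\<^sup>3\<^sup>k\<^sup>+\<^sup>2\<close> is zero. This is the vanishing of the
  residue of the exact differential \<open>w\<^sup>k dw\<close>, and it is why \<open>Q\<close> drops out below.
\<close>

lemma binomial_cancel: "(3 * k + 2) choose Suc k = 2 * ((3 * k + 2) choose k)"
proof -
  have "Suc k * ((3 * k + 2) choose Suc k) = (3 * k + 2) * ((3 * k + 1) choose k)"
    using Suc_times_binomial_eq[of "3*k+1" k] by simp
  also have "\<dots> = Suc k * (2 * ((3 * k + 2) choose k))"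
    using binomial_absorb_comp[of "3*k+2" k] by (simp add: algebra_simps)
  finally show ?thesis by (metis Suc_mult_cancel1)
qed

lemma fps_nth_one_minus_2X_shift:
  fixes Z :: "'a::comm_ring_1 fps"
  assumes "j < n"
  shows "fps_nth ((1 - 2 * fps_X) * (fps_X ^ (n - 1 - j) * Z)) (i + n)
       = fps_nth Z (Suc (i + j)) - 2 * fps_nth Z (i + j)"
proof -
  have "(1 - 2 * fps_X) * (fps_X ^ (n - 1 - j) * Z)
      = fps_X ^ (n - 1 - j) * Z - fps_const 2 * (fps_X ^ Suc (n - 1 - j) * Z)"
    by (simp add: algebra_simps numeral_fps_const)
  moreover have "i + n - (n - 1 - j) = Suc (i + j)" "i + n - Suc (n - 1 - j) = i + j"
    using assms by auto
  ultimately show ?thesis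
    using assms by (simp only: fps_sub_nth fps_mult_left_const_nth fps_X_power_mult_nth) auto
qed

text \<open>
  The hypothesis is the Pade relation \<open>s P(w) - \<kappa>(s) Q(w) = s\<^sup>n\<^sup>+\<^sup>1 R(s)\<close> multiplied by
  \<open>s\<^sup>n\<^sup>-\<^sup>1\<close>, which clears the denominators of the powers of \<open>w = (1 + s)\<^sup>3 / s\<close>. The factor
  \<open>1 - u s\<close> of \<open>\<kappa>\<close> cancels against the generating function, so that \<open>Q\<close> contributes nothing by
  \<open>binomial_cancel\<close>.
\<close>

lemma hankel_apply_of_identity:
  fixes x :: "'a::field_char_0" and R :: "'a fps"
  defines "u \<equiv> x - 1"
  assumes id: "(\<Sum>j\<le>n. fps_const (p j) * fps_X ^ (n - j) * (1 + fps_X) ^ (3 * j))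
     = (1 - 2 * fps_X) * (1 - fps_const u * fps_X) *
         (\<Sum>j<n. fps_const (q j) * fps_X ^ (n - 1 - j) * (1 + fps_X) ^ (3 * j))
       + fps_X ^ (2 * n) * R"
    and i: "i \<le> n"
  shows "(\<Sum>j\<le>n. a_poly (i + j) x * p j) = (if i = n then fps_nth R 0 else 0)"
proof -
  let ?Y = "1 + fps_X :: 'a fps" and ?G = "geom_fps u"
  have shift: "fps_nth F (i + j) = fps_nth (fps_X ^ (n - j) * F) (i + n)" if "j \<le> n" for F :: "'a fps" and j
    using that by (simp add: fps_X_power_mult_nth)
  have "(\<Sum>j\<le>n. a_poly (i + j) x * p j)
      = (\<Sum>j\<le>n. fps_nth (fps_const (p j) * fps_X ^ (n - j) * ?Y ^ (3 * j) * (?Y ^ (3 * i + 2) * ?G)) (i + n))"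
  proof (rule sum.cong[OF refl])
    fix j assume "j \<in> {..n}"
    then have "j \<le> n" by simp
    have "a_poly (i + j) x * p j = fps_nth (fps_const (p j) * (?Y ^ (3 * (i + j) + 2) * ?G)) (i + j)"
      by (simp only: a_poly_eq_fps_nth u_def fps_mult_left_const_nth mult.commute)
    also have "\<dots> = fps_nth (fps_X ^ (n - j) * (fps_const (p j) * (?Y ^ (3 * (i + j) + 2) * ?G))) (i + n)"
      by (rule shift) fact
    also have "fps_X ^ (n - j) * (fps_const (p j) * (?Y ^ (3 * (i + j) + 2) * ?G))
        = fps_const (p j) * fps_X ^ (n - j) * ?Y ^ (3 * j) * (?Y ^ (3 * i + 2) * ?G)"
      by (simp only: power_add distrib_left distrib_right mult_ac)
    finally show "a_poly (i + j) x * p j = fps_nth (fps_const (p j) * fps_X ^ (n - j) * ?Y ^ (3 * j) * (?Y ^ (3 * i + 2) * ?G)) (i + n)" .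
  qed
  also have "\<dots> = fps_nth ((\<Sum>j\<le>n. fps_const (p j) * fps_X ^ (n - j) * ?Y ^ (3 * j)) * (?Y ^ (3 * i + 2) * ?G)) (i + n)"
    by (simp only: sum_distrib_right fps_sum_nth)
  also have "(\<Sum>j\<le>n. fps_const (p j) * fps_X ^ (n - j) * ?Y ^ (3 * j)) * (?Y ^ (3 * i + 2) * ?G)
    = ((1 - fps_const u * fps_X) * ?G) * (\<Sum>j<n. fps_const (q j) * ((1 - 2 * fps_X) * (fps_X ^ (n - 1 - j) * ?Y ^ (3 * j + (3 * i + 2)))))
      + fps_X ^ (2 * n) * (R * (?Y ^ (3 * i + 2) * ?G))"
    unfolding id sum_distrib_left power_add by (simp add: sum_distrib_left sum_distrib_right ring_distribs mult_ac)
  also have "fps_nth \<dots> (i + n) = (\<Sum>j<n. q j * fps_nth ((1 - 2 * fps_X) * (fps_X ^ (n - 1 - j) * ?Y ^ (3 * j + (3 * i + 2)))) (i + n))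
      + fps_nth (fps_X ^ (2 * n) * (R * (?Y ^ (3 * i + 2) * ?G))) (i + n)"
    by (simp only: one_minus_times_geom_fps mult_1_left fps_add_nth fps_sum_nth fps_mult_left_const_nth)
  also have "(\<Sum>j<n. q j * fps_nth ((1 - 2 * fps_X) * (fps_X ^ (n - 1 - j) * ?Y ^ (3 * j + (3 * i + 2)))) (i + n)) = 0"
  proof (intro sum.neutral ballI)
    fix j assume "j \<in> {..<n}"
    then have j: "j < n" by simp
    let ?N = "3 * (i + j) + 2"
    have N: "3 * j + (3 * i + 2) = ?N" by simp
    have "fps_nth ((1 - 2 * fps_X) * (fps_X ^ (n - 1 - j) * ?Y ^ ?N)) (i + n)
       = of_nat (?N choose Suc (i + j)) - 2 * of_nat (?N choose (i + j))"
      unfolding fps_nth_one_minus_2X_shift[OF j] one_plus_fps_X_power_nth ..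
    then show "q j * fps_nth ((1 - 2 * fps_X) * (fps_X ^ (n - 1 - j) * ?Y ^ (3 * j + (3 * i + 2)))) (i + n) = 0"
      unfolding N binomial_cancel by simp
  qed
  also have "0 + fps_nth (fps_X ^ (2 * n) * (R * (?Y ^ (3 * i + 2) * ?G))) (i + n) = (if i = n then fps_nth R 0 else 0)"
    using i by (auto simp: fps_X_power_mult_nth one_plus_fps_X_power_nth geom_fps_def mult_2)
  finally show ?thesis .
qed


section \<open>Cramer's rule for the last column\<close>

text \<open>
  If \<open>A p\<close> is a multiple of the last unit vector, then replacing the last column of \<open>A\<close> by
  \<open>A p\<close> leaves only one cofactor.
\<close>

lemma det_last_column:
  fixes A :: "'a::comm_ring_1 mat"
  assumes A: "A \<in> carrier_mat (Suc n) (Suc n)" and p: "p \<in> carrier_vec (Suc n)"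
    and Ap: "A *\<^sub>v p = c \<cdot>\<^sub>v unit_vec (Suc n) n"
  shows "p $ n * det A = c * det (mat_delete A n n)"
proof -
  let ?B = "replace_col A (A *\<^sub>v p) n"
  have B: "?B \<in> carrier_mat (Suc n) (Suc n)" using A by (auto simp: replace_col_def)
  have "p $ n * det A = det ?B"
    using cramer_lemma_mat[OF A p, of n] by simp
  also have "\<dots> = (\<Sum>i<Suc n. ?B $$ (i, n) * cofactor ?B i n)"
    by (rule laplace_expansion_column[OF B]) simp
  also have "\<dots> = (\<Sum>i<Suc n. if i = n then c * cofactor ?B n n else 0)"
    using A by (intro sum.cong) (auto simp: replace_col_def Ap unit_vec_def)
  also have "\<dots> = c * cofactor ?B n n" by (simp add: sum.delta)
  also have "mat_delete ?B n n = mat_delete A n n"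
    using A by (intro eq_matI) (auto simp: mat_delete_def replace_col_def)
  then have "cofactor ?B n n = det (mat_delete A n n)"
    by (simp add: cofactor_def)
  finally show ?thesis .
qed

lemma H_last_column:
  fixes x :: "'a::field_char_0"
  assumes "\<And>i. i \<le> Suc n \<Longrightarrow> (\<Sum>j\<le>Suc n. a_poly (i + j) x * p j) = (if i = Suc n then c else 0)"
  shows "p (Suc n) * H (Suc n) x = c * H n x"
proof -
  let ?A = "mat (Suc (Suc n)) (Suc (Suc n)) (\<lambda>(i, j). a_poly (i + j) x)"
  let ?p = "vec (Suc (Suc n)) p"
  have "?A *\<^sub>v ?p = c \<cdot>\<^sub>v unit_vec (Suc (Suc n)) (Suc n)"
    using assms by (intro eq_vecI)
      (auto simp: scalar_prod_def unit_vec_def atLeast0LessThan lessThan_Suc_atMost less_Suc_eq_le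
            simp del: sum.atMost_Suc sum.lessThan_Suc)
  then have "?p $ Suc n * det ?A = c * det (mat_delete ?A (Suc n) (Suc n))"
    by (intro det_last_column) auto
  moreover have "mat_delete ?A (Suc n) (Suc n) = mat (Suc n) (Suc n) (\<lambda>(i, j). a_poly (i + j) x)"
    by (intro eq_matI) (auto simp: mat_delete_def)
  ultimately show ?thesis by (simp add: H_def)
qed

section \<open>Reduction of powers modulo the cubic relation\<close>

text \<open>
  The recurrence satisfied by the powers of \<open>s\<close> over the polynomials in \<open>w\<close>, where
  \<open>w = (1 + s)\<^sup>3 / s\<close>, that is \<open>s\<^sup>3 = (w - 3) s - 3 s\<^sup>2 - 1\<close>. The indeterminate of the polynomials
  stands for \<open>w\<close>.
\<close>

fun red_seq :: "'a::comm_ring_1 poly \<Rightarrow> 'a poly \<Rightarrow> 'a poly \<Rightarrow> nat \<Rightarrow> 'a poly" where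
  "red_seq a b c 0 = a"
| "red_seq a b c (Suc 0) = b"
| "red_seq a b c (Suc (Suc 0)) = c"
| "red_seq a b c (Suc (Suc (Suc k))) =
     [:-3, 1:] * red_seq a b c (Suc k) - smult 3 (red_seq a b c (Suc (Suc k))) - red_seq a b c k"

text \<open>
  The components of \<open>s\<^sup>k\<^sup>+\<^sup>1\<close> with respect to \<open>s\<close>, \<open>-\<kappa>(s)\<close> and \<open>s\<^sup>2\<close>. The index is shifted by
  one, so that the three initial values are those of \<open>s\<close>, \<open>s\<^sup>2\<close> and \<open>s\<^sup>3\<close>; the last one reads
  \<open>s\<^sup>3 = (w - 5 - u) s - \<kappa>(s) + (2 u - 3) s\<^sup>2\<close>.
\<close>

abbreviation "redP u \<equiv> red_seq 1 0 [:- 5 - u, 1:]"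
abbreviation "redQ \<equiv> red_seq 0 0 1"
abbreviation "redT u \<equiv> red_seq 0 1 [:2 * u - 3:]"

lemma red_seq_induct [case_names 0 1 2 step]:
  assumes "P 0" "P (Suc 0)" "P (Suc (Suc 0))"
    and "\<And>k. P k \<Longrightarrow> P (Suc k) \<Longrightarrow> P (Suc (Suc k)) \<Longrightarrow> P (Suc (Suc (Suc k)))"
  shows "P (k :: nat)"
proof -
  have "P k \<and> P (Suc k) \<and> P (Suc (Suc k))" by (induction k) (use assms in auto)
  then show ?thesis by simp
qed

lemma power_reduction:
  fixes s u :: "'a::field"
  assumes s: "s \<noteq> 0"
  defines "w \<equiv> (1 + s) ^ 3 / s"
  shows "s ^ Suc k = s * poly (redP u k) w - (1 - 2 * s) * (1 - u * s) * poly (redQ k) w + s\<^sup>2 * poly (redT u k) w"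
proof -
  \<comment> \<open>The relation \<open>s w = (1 + s)\<^sup>3\<close>, solved for \<open>s\<^sup>3\<close>.\<close>
  have cub: "s ^ 3 = s * w - 1 - 3 * s - 3 * s\<^sup>2"
  proof -
    have "s * w = (1 + s) ^ 3" using s by (simp add: w_def)
    then show ?thesis by (simp add: power3_eq_cube power2_eq_square algebra_simps)
  qed
  have pow_rec: "s ^ Suc (Suc (Suc k)) = (w - 3) * s ^ Suc k - 3 * s ^ Suc (Suc k) - s ^ k" for k
    using arg_cong[OF cub, of "\<lambda>z. z * s ^ k"]
    by (simp add: algebra_simps power2_eq_square power3_eq_cube)
  show ?thesis
  proof (induction k rule: red_seq_induct)
    case 2
    show ?case using cub by (simp add: algebra_simps power2_eq_square power3_eq_cube)
  next
    case (step k)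
    show ?case unfolding pow_rec[of "Suc k"] step.IH by (simp add: algebra_simps)
  qed (simp_all add: power2_eq_square)
qed

lemma coeff_red_seq_step:
  "coeff (red_seq a b c (Suc (Suc (Suc k)))) j
   = (case j of 0 \<Rightarrow> 0 | Suc i \<Rightarrow> coeff (red_seq a b c (Suc k)) i)
     - 3 * coeff (red_seq a b c (Suc k)) j - 3 * coeff (red_seq a b c (Suc (Suc k))) j - coeff (red_seq a b c k) j"
  by (cases j) simp_all

lemma coeff_redP_eq_0: "k < 2 * j \<Longrightarrow> coeff (redP u k) j = 0"
proof (induction k arbitrary: j rule: red_seq_induct)
  case (step k)
  then show ?case unfolding coeff_red_seq_step by (cases j) auto
qed (auto simp: coeff_pCons split: nat.splits)

lemma coeff_redP_top: "coeff (redP u (2 * j)) j = 1"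
proof (induction j)
  case (Suc j)
  show ?case
  proof (cases j)
    case (Suc i)
    have e: "2 * Suc j = Suc (Suc (Suc (2 * i + 1)))" "Suc (2 * i + 1) = 2 * j" using Suc by auto
    show ?thesis unfolding e(1) coeff_red_seq_step e(2)
      using Suc.IH by (simp add: coeff_redP_eq_0 Suc)
  qed (simp add: numeral_2_eq_2)
qed simp

lemma coeff_redQ_eq_0: "k < 2 * j + 2 \<Longrightarrow> coeff (redQ k) j = 0"
proof (induction k arbitrary: j rule: red_seq_induct)
  case (step k)
  then show ?case unfolding coeff_red_seq_step by (cases j) auto
qed (auto simp: coeff_pCons split: nat.splits)

text \<open>
  The \<open>s\<^sup>2\<close>-component is explicit: for binomial coefficients the recurrence is the statement that
  the third difference of \<open>C(N, m + 3)\<close> in \<open>N\<close> is \<open>C(N, m)\<close>.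
\<close>

lemma coeff_redT:
  "coeff (redT u k) j = (-1) ^ Suc k * (of_nat ((k + 1 + j) choose (3 * j + 2)) - 2 * u * of_nat ((k + j) choose (3 * j + 2)))"
proof (induction k arbitrary: j rule: red_seq_induct)
  case 0
  show ?case by (cases j) (simp_all add: binomial_eq_0)
next
  case 1
  show ?case by (cases j) (simp_all add: binomial_eq_0)
next
  case 2
  show ?case by (cases j) (simp_all add: binomial_eq_0)
next
  case (step k)
  show ?case
  proof (cases j)
    case 0
    then show ?thesis unfolding coeff_red_seq_step step by (simp add: numeral_eq_Suc algebra_simps)
  next
    case (Suc i)
    have e: "3 * Suc i + 2 = Suc (Suc (Suc (3 * i + 2)))" by simp
    show ?thesis unfolding coeff_red_seq_step step Suc e by (simp add: algebra_simps)
  qed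
qed

section \<open>From a Pade relation to consecutive Hankel determinants\<close>

lemma poly_eqI_off_finite:
  fixes p q :: "'a::{idom,ring_char_0} poly"
  assumes "finite S" "\<And>x. x \<notin> S \<Longrightarrow> poly p x = poly q x"
  shows "p = q"
proof (rule ccontr)
  assume "p \<noteq> q"
  then have fin: "finite {x. poly (p - q) x = 0}" by (intro poly_roots_finite) simp
  have "UNIV = S \<union> {x. poly (p - q) x = 0}" using assms(2) by auto
  then have "finite (UNIV :: 'a set)" using assms(1) fin by (metis finite_Un)
  then show False using infinite_UNIV_char_0 by blast
qed

lemma poly_altdef_le:
  assumes "degree p \<le> n"
  shows "poly p (x :: 'a::comm_semiring_1) = (\<Sum>i\<le>n. coeff p i * x ^ i)"
  unfolding poly_altdef
  by (rule sum.mono_neutral_left) (use assms in \<open>auto simp: coeff_eq_0\<close>)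

text \<open>
  In terms of \<open>T(s) = (s + 2 u) R(s)\<close> the vanishing of the \<open>s\<^sup>2\<close>-component of \<open>s\<^sup>n\<^sup>+\<^sup>1 R(s)\<close> is a
  system of linear conditions with constant coefficients.
\<close>

lemma redT_combination_zero:
  fixes u :: "'a::field_char_0"
  assumes deg: "degree R \<le> n"
    and mom: "\<And>j. (\<Sum>i\<le>Suc n. (-1) ^ i * coeff ([:2 * u, 1:] * R) i * of_nat ((n + i + j) choose (3 * j + 2))) = 0"
  shows "(\<Sum>i\<le>n. smult (coeff R i) (redT u (n + i))) = 0"
proof (rule poly_eqI)
  fix j
  let ?b = "\<lambda>i. of_nat ((n + i + j) choose (3 * j + 2)) :: 'a"
  have R0: "coeff R (Suc n) = 0" using deg by (simp add: coeff_eq_0)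
  have cT: "coeff ([:2 * u, 1:] * R) i = 2 * u * coeff R i + (case i of 0 \<Rightarrow> 0 | Suc k \<Rightarrow> coeff R k)" for i
    by (cases i) simp_all
  have "0 = (\<Sum>i\<le>Suc n. (-1) ^ i * coeff ([:2 * u, 1:] * R) i * ?b i)" by (rule mom[symmetric])
  also have "\<dots> = (\<Sum>i\<le>Suc n. (-1) ^ i * (2 * u * coeff R i) * ?b i)
     + (\<Sum>i\<le>Suc n. (-1) ^ i * (case i of 0 \<Rightarrow> 0 | Suc k \<Rightarrow> coeff R k) * ?b i)"
    unfolding cT sum.distrib[symmetric] by (simp only: distrib_left distrib_right)
  also have "(\<Sum>i\<le>Suc n. (-1) ^ i * (2 * u * coeff R i) * ?b i) = (\<Sum>i\<le>n. (-1) ^ i * (2 * u * coeff R i) * ?b i)"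
    by (simp only: sum.atMost_Suc R0) simp
  also have "(\<Sum>i\<le>Suc n. (-1) ^ i * (case i of 0 \<Rightarrow> 0 | Suc k \<Rightarrow> coeff R k) * ?b i)
      = (\<Sum>i\<le>n. (-1) ^ Suc i * coeff R i * ?b (Suc i))"
    unfolding sum.atMost_Suc_shift by simp
  finally have *: "(\<Sum>i\<le>n. (-1) ^ i * (2 * u * coeff R i) * ?b i - (-1) ^ i * coeff R i * ?b (Suc i)) = 0"
    by (simp add: sum.distrib sum_subtractf sum_negf)
  have "coeff (\<Sum>i\<le>n. smult (coeff R i) (redT u (n + i))) j
     = (\<Sum>i\<le>n. (-1) ^ n * ((-1) ^ i * (2 * u * coeff R i) * ?b i - (-1) ^ i * coeff R i * ?b (Suc i)))"
    unfolding coeff_sum coeff_smult coeff_redT by (intro sum.cong refl) (simp add: power_add algebra_simps)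
  also have "\<dots> = 0" unfolding sum_distrib_left[symmetric] * by simp
  finally show "coeff (\<Sum>i\<le>n. smult (coeff R i) (redT u (n + i))) j = coeff 0 j" by simp
qed

text \<open>
  The Pade relation of \<open>R\<close>, multiplied by \<open>s\<^sup>n\<^sup>-\<^sup>1\<close>. It is checked at all nonzero points \<open>s\<close> of
  the infinite field.
\<close>

lemma hankel_identity_of_R:
  fixes u :: "'a::field_char_0"
  assumes n: "n > 0" and deg: "degree R \<le> n"
    and mom: "\<And>j. (\<Sum>i\<le>Suc n. (-1) ^ i * coeff ([:2 * u, 1:] * R) i * of_nat ((n + i + j) choose (3 * j + 2))) = 0"
  defines "P \<equiv> \<Sum>i\<le>n. smult (coeff R i) (redP u (n + i))"
    and "Q \<equiv> \<Sum>i\<le>n. smult (coeff R i) (redQ (n + i))"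
  shows "(\<Sum>j\<le>n. smult (coeff P j) ([:0, 1:] ^ (n - j) * [:1, 1:] ^ (3 * j)))
     = [:1, -2:] * [:1, -u:] * (\<Sum>j<n. smult (coeff Q j) ([:0, 1:] ^ (n - 1 - j) * [:1, 1:] ^ (3 * j)))
       + [:0, 1:] ^ (2 * n) * R" (is "?L = ?R")
proof (rule poly_eqI_off_finite[of "{0}"])
  fix s :: 'a assume "s \<notin> {0}"
  then have s: "s \<noteq> 0" by simp
  define w where "w = (1 + s) ^ 3 / s"
  have degP: "degree P \<le> n"
    unfolding P_def by (intro degree_sum_le order.trans[OF degree_smult_le] degree_le) (auto simp: coeff_redP_eq_0)
  have degQ: "degree Q \<le> n - 1"
    unfolding Q_def by (intro degree_sum_le order.trans[OF degree_smult_le] degree_le) (auto simp: coeff_redQ_eq_0)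
  have w: "s ^ (m - j) * (1 + s) ^ (3 * j) = s ^ m * w ^ j" if "j \<le> m" for m j
    using s that by (simp add: w_def power_divide power_mult power_diff)
  have "s ^ Suc n * poly R s = (\<Sum>i\<le>n. coeff R i * s ^ Suc (n + i))"
    by (simp add: poly_altdef_le[OF deg] sum_distrib_left power_add mult_ac)
  also have "\<dots> = (\<Sum>i\<le>n. coeff R i * (s * poly (redP u (n + i)) w - (1 - 2 * s) * (1 - u * s) * poly (redQ (n + i)) w + s\<^sup>2 * poly (redT u (n + i)) w))"
    unfolding power_reduction[OF s, of _ u, folded w_def] ..
  also have "\<dots> = s * poly P w - (1 - 2 * s) * (1 - u * s) * poly Q w + s\<^sup>2 * poly (\<Sum>i\<le>n. smult (coeff R i) (redT u (n + i))) w"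
    by (simp add: P_def Q_def poly_sum sum_distrib_left sum.distrib sum_subtractf algebra_simps)
  also have "\<dots> = s * poly P w - (1 - 2 * s) * (1 - u * s) * poly Q w"
    unfolding redT_combination_zero[OF deg mom] by simp
  finally have main: "s * poly P w = (1 - 2 * s) * (1 - u * s) * poly Q w + s ^ Suc n * poly R s" by simp
  obtain m where m: "n = Suc m" using n by (cases n) auto
  have "poly ?L s = (\<Sum>j\<le>n. coeff P j * (s ^ (n - j) * (1 + s) ^ (3 * j)))"
    by (simp add: poly_sum mult_ac)
  also have "\<dots> = (\<Sum>j\<le>n. coeff P j * (s ^ n * w ^ j))" by (intro sum.cong refl) (simp add: w)
  also have "\<dots> = s ^ n * poly P w"
    by (simp add: poly_altdef_le[OF degP] sum_distrib_left mult_ac)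
  also have "\<dots> = s ^ m * (s * poly P w)" by (simp add: m)
  also have "\<dots> = (1 - 2 * s) * (1 - u * s) * (s ^ m * poly Q w) + s ^ (2 * n) * poly R s"
  proof -
    have "2 * n = m + Suc n" by (simp add: m)
    then have "s ^ (2 * n) = s ^ m * s ^ Suc n" by (simp only: power_add)
    then show ?thesis unfolding main by (simp only: distrib_left mult_ac)
  qed
  also have "s ^ m * poly Q w = (\<Sum>j\<le>m. coeff Q j * (s ^ m * w ^ j))"
    using degQ by (simp add: poly_altdef_le[of Q m] m sum_distrib_left mult_ac)
  also have "\<dots> = (\<Sum>j\<le>m. coeff Q j * (s ^ (m - j) * (1 + s) ^ (3 * j)))"
    by (intro sum.cong refl) (simp add: w)
  also have "(1 - 2 * s) * (1 - u * s) * \<dots> + s ^ (2 * n) * poly R s = poly ?R s"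
  proof -
    have "poly ([:1, -2:] * [:1, -u:]) s = (1 - 2 * s) * (1 - u * s)"
      unfolding poly_mult by (simp add: mult.commute)
    moreover have "poly (\<Sum>j<n. smult (coeff Q j) ([:0, 1:] ^ (n - 1 - j) * [:1, 1:] ^ (3 * j))) s
        = (\<Sum>j\<le>m. coeff Q j * (s ^ (m - j) * (1 + s) ^ (3 * j)))"
      by (simp add: poly_sum m lessThan_Suc_atMost)
    ultimately show ?thesis
      by (simp only: poly_add poly_mult poly_power) simp
  qed
  finally show "poly ?L s = poly ?R s" .
qed simp

lemma hankel_step_of_R:
  fixes x :: "'a::field_char_0"
  assumes deg: "degree R \<le> Suc n"
    and mom: "\<And>j. (\<Sum>i\<le>Suc (Suc n). (-1) ^ i * coeff ([:2 * (x - 1), 1:] * R) i * of_nat ((Suc n + i + j) choose (3 * j + 2))) = 0"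
  shows "coeff R (Suc n) * H (Suc n) x = coeff R 0 * H n x"
proof -
  define N u where "N = Suc n" and "u = x - 1"
  define P where "P = (\<Sum>i\<le>N. smult (coeff R i) (redP u (N + i)))"
  define Q where "Q = (\<Sum>i\<le>N. smult (coeff R i) (redQ (N + i)))"
  have "(\<Sum>j\<le>N. smult (coeff P j) ([:0, 1:] ^ (N - j) * [:1, 1:] ^ (3 * j)))
     = [:1, -2:] * [:1, -u:] * (\<Sum>j<N. smult (coeff Q j) ([:0, 1:] ^ (N - 1 - j) * [:1, 1:] ^ (3 * j)))
       + [:0, 1:] ^ (2 * N) * R"
    unfolding P_def Q_def using deg mom by (intro hankel_identity_of_R) (simp_all add: N_def u_def)
  then have "fps_of_poly (\<Sum>j\<le>N. smult (coeff P j) ([:0, 1:] ^ (N - j) * [:1, 1:] ^ (3 * j)))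
     = fps_of_poly ([:1, -2:] * [:1, -u:] * (\<Sum>j<N. smult (coeff Q j) ([:0, 1:] ^ (N - 1 - j) * [:1, 1:] ^ (3 * j)))
       + [:0, 1:] ^ (2 * N) * R)" by (rule arg_cong)
  moreover have "fps_of_poly [:0, 1:] = (fps_X :: 'a fps)" "fps_of_poly [:1, 1:] = (1 + fps_X :: 'a fps)"
    "fps_of_poly [:1, -2:] = (1 - 2 * fps_X :: 'a fps)" "fps_of_poly [:1, -u:] = 1 - fps_const u * fps_X"
    by (simp_all add: fps_of_poly_pCons numeral_fps_const fps_eq_iff)
  ultimately have id: "(\<Sum>j\<le>N. fps_const (coeff P j) * fps_X ^ (N - j) * (1 + fps_X) ^ (3 * j))
     = (1 - 2 * fps_X) * (1 - fps_const u * fps_X) *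
         (\<Sum>j<N. fps_const (coeff Q j) * fps_X ^ (N - 1 - j) * (1 + fps_X) ^ (3 * j))
       + fps_X ^ (2 * N) * fps_of_poly R"
    by (simp only: fps_of_poly_sum fps_of_poly_smult fps_of_poly_mult fps_of_poly_power fps_of_poly_add mult.assoc)
  have "coeff P (Suc n) * H (Suc n) x = coeff R 0 * H n x"
    using hankel_apply_of_identity[OF id[unfolded u_def]] by (intro H_last_column) (simp_all add: N_def)
  moreover have "coeff P N = coeff R N"
  proof -
    have "coeff P N = (\<Sum>i\<le>N. if i = N then coeff R N else 0)"
      unfolding P_def coeff_sum coeff_smult
      by (intro sum.cong refl) (auto simp: coeff_redP_eq_0 coeff_redP_top simp flip: mult_2)
    then show ?thesis by simp
  qed
  ultimately show ?thesis by (simp add: N_def)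
qed

section \<open>Jacobi polynomials\<close>

text \<open>
  The coefficients of \<open>J\<^sub>n\<close> in powers of \<open>s + 4\<close>, where \<open>s = -2 (x - 1)\<close> and therefore
  \<open>s + 4 = -2 (x - 3)\<close>. They are set to zero beyond index \<open>n\<close>, where the subtraction \<open>n - i\<close>
  would be truncated.
\<close>

definition jac_coeff :: "nat \<Rightarrow> nat \<Rightarrow> 'a::field_char_0" where
  "jac_coeff n i = (if i \<le> n then
     (-1) ^ i * (fact n * fact (3 * n + i + 2)) / (fact (3 * n + 2) * fact (n - i) * fact (2 * i + 1)) else 0)"

text \<open>
  Up to a constant factor \<open>J\<^sub>n(s)\<close> is the Jacobi polynomial with parameters \<open>1/2\<close> and
  \<open>2 n + 3/2\<close> in the variable \<open>-1 - s/2\<close>.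
\<close>

definition jac :: "nat \<Rightarrow> 'a::field_char_0 poly" where
  "jac n = pcompose (\<Sum>i\<le>n. monom (jac_coeff n i) i) [:4, 1:]"

lemma poly_jac: "poly (jac n) s = (\<Sum>i\<le>n. jac_coeff n i * (s + 4) ^ i)"
  by (simp add: jac_def poly_pcompose poly_sum poly_monom add.commute)

lemma jac_coeff_Suc:
  "of_nat ((2 * i + 2) * (2 * i + 3)) * jac_coeff n (Suc i)
   = (of_nat i - of_nat n) * of_nat (i + 3 * n + 3) * (jac_coeff n i :: 'a::field_char_0)"
proof (cases "i < n")
  case True
  then obtain d where d: "n = Suc (i + d)" using less_iff_Suc_add by auto
  define A B C D E :: 'a where "A = fact n" and "B = fact (3 * n + i + 2)" and "C = fact (3 * n + 2)"
    and "D = fact (n - Suc i)" and "E = fact (2 * i + 1)"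
  define a b c :: 'a where "a = of_nat ((2 * i + 2) * (2 * i + 3))" and "b = of_nat (i + 3 * n + 3)"
    and "c = of_nat n - of_nat i"
  have nz: "A \<noteq> 0" "B \<noteq> 0" "C \<noteq> 0" "D \<noteq> 0" "E \<noteq> 0" unfolding A_def B_def C_def D_def E_def by (rule fact_nonzero)+
  have 1: "fact (2 * Suc i + 1) = a * E"
    by (simp add: a_def E_def algebra_simps)
  have 2: "fact (3 * n + Suc i + 2) = b * B"
    by (simp add: b_def B_def algebra_simps)
  have 3: "fact (n - i) = c * D"
    by (simp add: c_def D_def d algebra_simps)
  have 4: "c \<noteq> 0" using True by (simp add: c_def)
  have 5: "a \<noteq> 0" unfolding a_def by (simp only: of_nat_eq_0_iff) simp
  have "jac_coeff n (Suc i) = (- 1) ^ Suc i * (A * (b * B)) / (C * D * (a * E))"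
    using True unfolding jac_coeff_def 1 2 A_def C_def D_def by (simp only: Suc_le_eq if_True)
  then have "a * jac_coeff n (Suc i) = - (b * ((- 1) ^ i * (A * B) / (C * D * E)))"
    using nz 5 by (simp add: field_simps)
  moreover have "jac_coeff n i = (- 1) ^ i * (A * B) / (C * (c * D) * E)"
    using True unfolding jac_coeff_def 3 A_def B_def C_def E_def by simp
  then have "c * jac_coeff n i = (- 1) ^ i * (A * B) / (C * D * E)"
    using nz 4 by (simp add: field_simps)
  moreover have "of_nat i - of_nat n = - c" by (simp add: c_def)
  ultimately show ?thesis unfolding a_def[symmetric] b_def[symmetric]
    by (simp only: mult_minus_left mult_ac) simp
next
  case False
  then show ?thesis by (cases "i = n") (auto simp: jac_coeff_def)
qed

text \<open>
  The hypergeometric differential equation, with singular points \<open>0\<close>, \<open>-4\<close> and infinity. It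
  serves to pass from the expansion of \<open>J\<^sub>n\<close> at \<open>-4\<close>, where it is defined, to the one at \<open>0\<close>.
\<close>

lemma jac_ode:
  fixes n :: nat
  defines "V \<equiv> (jac n :: 'a::field_char_0 poly)"
  shows "[:0, 4, 1:] * pderiv (pderiv V) + [:of_nat (8 * n + 10), of_nat (2 * n + 4):] * pderiv V
     = smult (of_nat (3 * n * (n + 1))) V"
proof -
  define W :: "'a poly" where "W = (\<Sum>i\<le>n. monom (jac_coeff n i) i)"
  have cW: "coeff W i = jac_coeff n i" for i
    by (auto simp: W_def coeff_sum coeff_monom jac_coeff_def)
  have V: "V = pcompose W [:4, 1:]" by (simp add: V_def jac_def W_def)
  have "[:0, -4, 1:] * pderiv (pderiv W) + [:-6, of_nat (2 * n + 4):] * pderiv W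
     = smult (of_nat (3 * n * (n + 1))) W"
  proof (rule poly_eqI)
    fix i
    have r: "of_nat ((2 * i + 2) * (2 * i + 3)) * jac_coeff n (Suc i)
      = (of_nat i - of_nat n) * of_nat (i + 3 * n + 3) * (jac_coeff n i :: 'a)" by (rule jac_coeff_Suc)
    show "coeff ([:0, -4, 1:] * pderiv (pderiv W) + [:-6, of_nat (2 * n + 4):] * pderiv W) i
       = coeff (smult (of_nat (3 * n * (n + 1))) W) i"
    proof (cases i)
      case 0 then show ?thesis using r by (simp add: coeff_pderiv cW) (simp add: algebra_simps)
    next
      case (Suc k)
      then show ?thesis using r
        by (cases k) (simp_all add: coeff_pderiv cW coeff_pCons algebra_simps)
    qed
  qed
  then have "pcompose ([:0, -4, 1:] * pderiv (pderiv W) + [:-6, of_nat (2 * n + 4):] * pderiv W) [:4, 1:]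
     = pcompose (smult (of_nat (3 * n * (n + 1))) W) [:4, 1:]" by simp
  moreover have "pderiv V = pcompose (pderiv W) [:4, 1:]" "pderiv (pderiv V) = pcompose (pderiv (pderiv W)) [:4, 1:]"
    by (simp_all add: V pderiv_pcompose pderiv_pCons)
  moreover have "pcompose [:0, -4, 1:] [:4, 1:] = ([:0, 4, 1:] :: 'a poly)" 
     "pcompose [:-6, of_nat (2 * n + 4):] [:4, 1:] = ([:of_nat (8 * n + 10), of_nat (2 * n + 4):] :: 'a poly)"
    by (simp_all add: pcompose_pCons algebra_simps)
  ultimately show ?thesis by (simp only: V pcompose_add pcompose_mult pcompose_smult)
qed

lemma coeff_jac_Suc:
  "of_nat (k + 1) * of_nat (4 * k + 8 * n + 10) * coeff (jac n) (Suc k)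
    = (of_nat n - of_nat k) * of_nat (k + 3 * n + 3) * (coeff (jac n) k :: 'a::field_char_0)"
proof -
  have "coeff ([:0, 4, 1:] * pderiv (pderiv (jac n)) + [:of_nat (8 * n + 10), of_nat (2 * n + 4):] * pderiv (jac n)) k
     = coeff (smult (of_nat (3 * n * (n + 1))) (jac n :: 'a poly)) k"
    by (simp only: jac_ode)
  then show ?thesis
  proof (cases k)
    case 0 with \<open>coeff _ k = _\<close> show ?thesis by (simp add: coeff_pderiv algebra_simps)
  next
    case (Suc m)
    with \<open>coeff _ k = _\<close> show ?thesis
        by (cases m) (simp_all add: coeff_pderiv coeff_pCons algebra_simps)
  qed
qed

lemma degree_jac_le: "degree (jac n) \<le> n"
  unfolding jac_def by (rule order.trans[OF degree_pcompose_le])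
    (auto intro!: degree_sum_le order.trans[OF degree_monom_le])

lemma jac_altdef: "jac n = (\<Sum>i\<le>n. smult (jac_coeff n i) ([:4, 1:] ^ i))"
  unfolding poly_eq_poly_eq_iff[symmetric] by (simp add: fun_eq_iff poly_jac poly_sum add.commute)

lemma coeff_jac_top: "coeff (jac n) n = (jac_coeff n n :: 'a::field_char_0)"
proof -
  have "coeff (jac n) n = (\<Sum>i\<le>n. jac_coeff n i * coeff ([:4, 1:] ^ i) n :: 'a)"
    by (simp add: jac_altdef coeff_sum)
  also have "\<dots> = (\<Sum>i\<le>n. if i = n then jac_coeff n i else 0)"
    by (intro sum.cong refl) (auto simp: coeff_linear_power coeff_eq_0 degree_power_eq)
  finally show ?thesis by simp
qed

lemma coeff_jac_chain:
  assumes "k \<le> n"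
  shows "coeff (jac n) k * (fact k * fact (n - k) * fact (3 * n + 2) * (\<Prod>i<k. of_nat (4 * i + 8 * n + 10)))
    = (coeff (jac n) 0 * (fact n * fact (3 * n + k + 2)) :: 'a::field_char_0)"
  using assms
proof (induction k)
  case 0 then show ?case by simp
next
  case (Suc k)
  have nk: "fact (n - k) = (of_nat (n - k) * fact (n - Suc k) :: 'a)"
    using Suc.prems fact_reduce[of "n - k", where 'a = 'a] by (simp add: of_nat_diff)
  let ?P = "\<Prod>i<k. of_nat (4 * i + 8 * n + 10) :: 'a"
  have "of_nat (n - k) * (coeff (jac n) (Suc k) * (fact (Suc k) * fact (n - Suc k) * fact (3 * n + 2) * (\<Prod>i<Suc k. of_nat (4 * i + 8 * n + 10))))
     = (of_nat (k + 1) * of_nat (4 * k + 8 * n + 10) * coeff (jac n) (Suc k)) * (fact k * fact (n - k) * fact (3 * n + 2) * ?P)"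
    unfolding nk by (simp add: mult_ac)
  also have "\<dots> = (of_nat n - of_nat k) * of_nat (k + 3 * n + 3) * (coeff (jac n) k * (fact k * fact (n - k) * fact (3 * n + 2) * ?P))"
    unfolding coeff_jac_Suc by (simp only: mult_ac)
  also have "\<dots> = of_nat (n - k) * (coeff (jac n) 0 * (fact n * fact (3 * n + Suc k + 2)))"
  proof -
    have "fact (3 * n + Suc k + 2) = (of_nat (k + 3 * n + 3) * fact (3 * n + k + 2) :: 'a)"
      by (simp add: algebra_simps)
    moreover have "of_nat (n - k) = (of_nat n - of_nat k :: 'a)" using Suc.prems by (simp add: of_nat_diff)
    ultimately show ?thesis using Suc by (simp only: mult_ac)
  qed
  finally show ?case using Suc.prems by simp
qed

text \<open>
  Up to signs, \<open>C(M, m)\<close> is the coefficient of \<open>y\<^sup>m\<close> in \<open>s\<^sup>M\<close>, where \<open>y = 1 + s\<close>. Read in this way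
  the identity evaluates the adjoint of the differential operator of \<open>jac_ode\<close> at
  \<open>s\<^sup>n\<^sup>+\<^sup>j\<^sup>+\<^sup>2 y\<^sup>-\<^sup>3\<^sup>j\<^sup>-\<^sup>4\<close>: apart from constants the result is
  \<open>s\<^sup>n\<^sup>+\<^sup>j\<^sup>+\<^sup>1 y\<^sup>-\<^sup>3\<^sup>j\<^sup>-\<^sup>3\<close> and its successor in \<open>j\<close>, the kernels of two consecutive moments.
\<close>

lemma binomial_certificate:
  fixes n j k :: nat
  defines "M \<equiv> n + 1 + j + k" and "m \<equiv> 3 * j + 3"
  shows "of_nat (k * (4 * k + 8 * n + 6)) * of_nat (M choose m)
       + (of_nat n - of_nat k) * of_nat (k + 3 * n + 3) * of_nat (Suc M choose m)
     = 2 * of_nat (n + j + 2) * (2 * of_nat n - 1 - 2 * of_nat j) * of_nat (M choose (3 * j + 2))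
       + 3 * of_nat (3 * j + 4) * of_nat (3 * j + 5) * (of_nat (Suc M choose (3 * j + 5)) :: 'a::field_char_0)"
proof -
  define B where "B = (of_nat (M choose (3 * j + 2)) :: 'a)"
  define C where "C = (of_nat (M choose m) :: 'a)"
  have r: "of_nat (Suc k) * of_nat (N choose Suc k) = (of_nat N - of_nat k) * (of_nat (N choose k) :: 'a)" for N k
  proof (cases "k \<le> N")
    case True
    have "Suc k * (N choose Suc k) = (N - k) * (N choose k)"
      using binomial_absorb_comp[of N k] Suc_times_binomial_eq[of "N - 1" k] True
      by (cases N) (auto simp: algebra_simps)
    then have "of_nat (Suc k * (N choose Suc k)) = (of_nat ((N - k) * (N choose k)) :: 'a)" by (rule arg_cong)
    then show ?thesis using True by (simp add: of_nat_diff distrib_right)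
  qed (simp add: binomial_eq_0)
  have sucs: "Suc (3 * j + 2) = m" "Suc m = 3 * j + 4" "Suc (3 * j + 4) = 3 * j + 5"
    by (simp_all add: m_def)
  have BC: "of_nat m * C = (of_nat M - of_nat (3 * j + 2)) * B"
    using r[of "3*j+2" M] unfolding sucs B_def C_def .
  have S: "of_nat (Suc M choose m) = B + C"
    unfolding B_def C_def sucs(1)[symmetric] by simp
  have "of_nat (3 * j + 4) * (of_nat (3 * j + 5) * of_nat (Suc M choose (3 * j + 5)))
      = (of_nat (Suc M) - of_nat (3 * j + 4)) * (of_nat (3 * j + 4) * (of_nat (Suc M choose (3 * j + 4)) :: 'a))"
    using arg_cong[OF r[of "3*j+4" "Suc M"], of "\<lambda>z. of_nat (3 * j + 4) * z"]
    unfolding sucs by (simp only: mult.left_commute)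
  also have "of_nat (3 * j + 4) * (of_nat (Suc M choose (3 * j + 4)) :: 'a) = (of_nat (Suc M) - of_nat m) * (B + C)"
    using r[of m "Suc M"] unfolding sucs S .
  finally have T: "of_nat (3 * j + 4) * of_nat (3 * j + 5) * of_nat (Suc M choose (3 * j + 5))
      = (of_nat (Suc M) - of_nat (3 * j + 4)) * ((of_nat (Suc M) - of_nat m) * (B + C))" by (simp only: mult.assoc)
  have *: "k' * (4 * k' + 8 * n' + 6) * C + (n' - k') * (k' + 3 * n' + 3) * (B + C)
      = 2 * (n' + j' + 2) * (2 * n' - 1 - 2 * j') * B
        + 3 * ((n' + k' - 2 * j' - 2) * ((n' + k' - 2 * j' - 1) * (B + C)))"
    if "(3 * j' + 3) * C = (n' + k' - 2 * j' - 1) * B" for n' j' k' :: 'a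
  proof -
    have "k' * (4 * k' + 8 * n' + 6) * C + (n' - k') * (k' + 3 * n' + 3) * (B + C)
      - (2 * (n' + j' + 2) * (2 * n' - 1 - 2 * j') * B
        + 3 * ((n' + k' - 2 * j' - 2) * ((n' + k' - 2 * j' - 1) * (B + C))))
      = (4 * (n' + k') - 4 * j' - 2) * ((3 * j' + 3) * C - (n' + k' - 2 * j' - 1) * B)"
      by (simp add: algebra_simps)
    then show ?thesis using that by simp
  qed
  have c: "of_nat m = (3 * of_nat j + 3 :: 'a)"
    "of_nat M - of_nat (3 * j + 2) = (of_nat n + of_nat k - 2 * of_nat j - 1 :: 'a)"
    "of_nat (Suc M) - of_nat (3 * j + 4) = (of_nat n + of_nat k - 2 * of_nat j - 2 :: 'a)"
    "of_nat (Suc M) - of_nat m = (of_nat n + of_nat k - 2 * of_nat j - 1 :: 'a)"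
    by (simp_all add: M_def m_def algebra_simps)
  have T': "3 * ((of_nat n + of_nat k - 2 * of_nat j - 2) * ((of_nat n + of_nat k - 2 * of_nat j - 1) * (B + C)))
      = 3 * of_nat (3 * j + 4) * of_nat (3 * j + 5) * (of_nat (Suc M choose (3 * j + 5)) :: 'a)"
    using T[unfolded c(2-4)] by (simp only: mult.assoc)
  show ?thesis
    unfolding S B_def[symmetric] C_def[symmetric]
    using *[OF BC[unfolded c(2), unfolded c(1)], unfolded T']
    by (simp only: of_nat_add of_nat_mult of_nat_numeral)
qed

text \<open>
  Up to sign, the coefficient of \<open>y\<^sup>3\<^sup>j\<^sup>+\<^sup>2\<close> in \<open>s\<^sup>n\<^sup>+\<^sup>j\<^sup>+\<^sup>1 J\<^sub>n(s)\<close> for \<open>s = y - 1\<close>.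
\<close>

definition jac_moment :: "nat \<Rightarrow> nat \<Rightarrow> 'a::field_char_0" where
  "jac_moment n j = (\<Sum>k\<le>n. (-1) ^ k * coeff (jac n) k * of_nat ((n + 1 + j + k) choose (3 * j + 2)))"

lemma jac_moment_rec:
  "2 * of_nat (n + j + 2) * (2 * of_nat n - 1 - 2 * of_nat j) * jac_moment n j
    + 3 * of_nat (3 * j + 4) * of_nat (3 * j + 5) * jac_moment n (Suc j) = (0 :: 'a::field_char_0)"
proof -
  define v where "v k = (-1) ^ k * coeff (jac n :: 'a poly) k" for k
  define g where "g k = (of_nat ((n + 1 + j + k) choose (3 * j + 3)) :: 'a)" for k
  have v0: "v (Suc n) = 0" using degree_jac_le[of n, where 'a = 'a] by (simp add: v_def coeff_eq_0)
  have v: "of_nat (Suc k * (4 * Suc k + 8 * n + 6)) * v (Suc k) = - ((of_nat n - of_nat k) * of_nat (k + 3 * n + 3) * v k)" for k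
  proof -
    have "of_nat (Suc k * (4 * Suc k + 8 * n + 6)) * v (Suc k)
       = - ((-1) ^ k * (of_nat (k + 1) * of_nat (4 * k + 8 * n + 10) * coeff (jac n) (Suc k)))"
      by (simp add: v_def algebra_simps)
    then show ?thesis unfolding coeff_jac_Suc by (simp add: v_def mult_ac)
  qed
  have "2 * of_nat (n + j + 2) * (2 * of_nat n - 1 - 2 * of_nat j) * jac_moment n j
      + 3 * of_nat (3 * j + 4) * of_nat (3 * j + 5) * jac_moment n (Suc j)
    = (\<Sum>k\<le>n. v k * (2 * of_nat (n + j + 2) * (2 * of_nat n - 1 - 2 * of_nat j) * of_nat ((n + 1 + j + k) choose (3 * j + 2))
       + 3 * of_nat (3 * j + 4) * of_nat (3 * j + 5) * of_nat (Suc (n + 1 + j + k) choose (3 * j + 5))))"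
  proof -
    have "n + 1 + Suc j + k = Suc (n + 1 + j + k)" "3 * Suc j + 2 = 3 * j + 5" for k by simp_all
    then show ?thesis unfolding jac_moment_def v_def sum_distrib_left sum.distrib[symmetric]
      by (simp only: distrib_left mult_ac)
  qed
  also have "\<dots> = (\<Sum>k\<le>n. v k * (of_nat (k * (4 * k + 8 * n + 6)) * g k + (of_nat n - of_nat k) * of_nat (k + 3 * n + 3) * g (Suc k)))"
    unfolding binomial_certificate[symmetric] g_def by simp
  also have "\<dots> = (\<Sum>k\<le>n. of_nat (k * (4 * k + 8 * n + 6)) * v k * g k - of_nat (Suc k * (4 * Suc k + 8 * n + 6)) * v (Suc k) * g (Suc k))"
\<comment> \<open>Rewriting one term by the coefficient recurrence \<open>v\<close> makes the sum telescope.\<close>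
    unfolding v mult_minus_left diff_minus_eq_add by (simp only: algebra_simps)
  also have "\<dots> = 0"
    using sum_telescope[of "\<lambda>k. of_nat (k * (4 * k + 8 * n + 6)) * v k * g k" n] by (simp only: v0) simp
  finally show ?thesis .
qed

text \<open>
  For \<open>j \<ge> n\<close> all binomial coefficients in the sum are zero. From there the recurrence descends,
  because \<open>2 n - 1 - 2 j\<close> is odd and so never zero.
\<close>

lemma jac_moment_zero: "jac_moment n j = (0 :: 'a::field_char_0)"
proof -
  have "jac_moment n (n - d) = (0 :: 'a)" if "d \<le> n" for d
    using that
  proof (induction d)
    case 0
    have "(n + 1 + n + k) choose (3 * n + 2) = 0" if "k \<le> n" for k
      by (rule binomial_eq_0) (use that in simp)
    then show ?case unfolding jac_moment_def by (intro sum.neutral ballI) (simp only: atMost_iff diff_zero of_nat_0 mult_zero_right)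
  next
    case (Suc d)
    define j where "j = n - Suc d"
    have "jac_moment n (Suc j) = (0 :: 'a)" using Suc by (simp add: j_def Suc_diff_Suc)
    with jac_moment_rec[of n j, where 'a = 'a]
    have "2 * of_nat (n + j + 2) * (2 * of_nat n - 1 - 2 * of_nat j) * jac_moment n j = (0 :: 'a)" by simp
    moreover have "2 * of_nat n - 1 - 2 * of_nat j \<noteq> (0 :: 'a)"
    proof
      assume "2 * of_nat n - 1 - 2 * of_nat j = (0 :: 'a)"
      then have "of_nat (2 * n) = (of_nat (2 * j + 1) :: 'a)" by (simp add: algebra_simps)
      then have "2 * n = 2 * j + 1" by (simp only: of_nat_eq_iff)
      then show False by presburger
    qed
    moreover have "of_nat (n + j + 2) \<noteq> (0 :: 'a)" unfolding of_nat_eq_0_iff by simp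
    ultimately have "jac_moment n j = (0 :: 'a)" by (metis mult_eq_0_iff zero_neq_numeral)
    then show ?case unfolding j_def .
  qed
  note * = this
  show ?thesis
  proof (cases "j \<le> n")
    case True
    then show ?thesis using *[of "n - j"] by simp
  next
    case False
    have "(n + 1 + j + k) choose (3 * j + 2) = 0" if "k \<le> n" for k
      by (rule binomial_eq_0) (use that False in simp)
    then show ?thesis unfolding jac_moment_def by (intro sum.neutral ballI) (simp only: atMost_iff of_nat_0 mult_zero_right)
  qed
qed

section \<open>The Hankel determinant up to its constant factor\<close>

text \<open>
  The case \<open>x = 1\<close> is left out because \<open>R(0)\<close> is read off from \<open>T(0) = 2 (x - 1) R(0)\<close>.
\<close>

lemma hankel_step:
  fixes x :: "'a::field_char_0"
  assumes x: "x \<noteq> 1"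
  defines "z \<equiv> - 2 * (x - 1)"
  shows "poly (jac n) z * coeff (jac (Suc n)) (Suc n) * H (Suc n) x
       = poly (jac (Suc n)) z * coeff (jac n) 0 * H n x"
proof -
  \<comment> \<open>The weights of \<open>s J\<^sub>n\<^sub>+\<^sub>1\<close> and \<open>J\<^sub>n\<close> are chosen to make \<open>T\<close> vanish at \<open>z\<close>.\<close>
  define a b where "a = poly (jac n) z" and "b = - z * poly (jac (Suc n)) z"
  define T where "T = smult a (pCons 0 (jac (Suc n))) + smult b (jac n)"
  have "poly T z = 0" by (simp add: T_def a_def b_def)
  then obtain R where R: "T = [:-z, 1:] * R" by (auto simp: poly_eq_0_iff_dvd elim: dvdE)
  have z: "z \<noteq> 0" using x by (simp add: z_def)
  have dj: "degree (jac m :: 'a poly) \<le> m" for m by (rule degree_jac_le)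
  have degT: "degree T \<le> Suc (Suc n)"
    unfolding T_def using dj[of n] dj[of "Suc n"]
    by (intro degree_add_le order.trans[OF degree_smult_le]) (auto simp: degree_pCons_eq_if)
  have degR: "degree R \<le> Suc n"
  proof (cases "R = 0")
    case False
    then have "degree T = Suc (degree R)" unfolding R by (subst degree_mult_eq) auto
    then show ?thesis using degT by simp
  qed simp
  have cR: "coeff T 0 = - z * coeff R 0" "coeff T (Suc (Suc n)) = coeff R (Suc n)"
    using degR by (simp_all add: R coeff_eq_0)
  have mom: "(\<Sum>i\<le>Suc (Suc n). (-1) ^ i * coeff T i * of_nat ((Suc n + i + j) choose (3 * j + 2))) = 0" for j
  proof -
    let ?c = "\<lambda>i. of_nat ((Suc n + i + j) choose (3 * j + 2)) :: 'a"
    have "(\<Sum>i\<le>Suc (Suc n). (-1) ^ i * coeff T i * ?c i)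
       = a * (\<Sum>i\<le>Suc (Suc n). (-1) ^ i * coeff (pCons 0 (jac (Suc n))) i * ?c i)
       + b * (\<Sum>i\<le>Suc (Suc n). (-1) ^ i * coeff (jac n) i * ?c i)"
      unfolding T_def sum_distrib_left sum.distrib[symmetric]
      by (intro sum.cong refl) (simp only: coeff_add coeff_smult algebra_simps)
    also have "(\<Sum>i\<le>Suc (Suc n). (-1) ^ i * coeff (pCons 0 (jac (Suc n))) i * ?c i) = - jac_moment (Suc n) j"
      unfolding sum.atMost_Suc_shift[of _ "Suc n"] jac_moment_def sum_negf[symmetric]
      by (simp add: add_ac del: sum.atMost_Suc binomial_Suc_Suc)
    also have "(\<Sum>i\<le>Suc (Suc n). (-1) ^ i * coeff (jac n) i * ?c i) = jac_moment n j"
      using dj[of n] unfolding jac_moment_def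
      by (simp add: coeff_eq_0 add_ac del: binomial_Suc_Suc)
    finally show ?thesis by (simp add: jac_moment_zero)
  qed
  have "coeff R (Suc n) * H (Suc n) x = coeff R 0 * H n x"
    using degR mom unfolding R by (intro hankel_step_of_R) (simp_all only: z_def minus_mult_left minus_minus)
  moreover have "coeff R (Suc n) = a * coeff (jac (Suc n)) (Suc n)"
    using cR(2) dj[of n] by (simp add: T_def coeff_eq_0)
  moreover have "coeff R 0 = poly (jac (Suc n)) z * coeff (jac n) 0"
    using cR(1) z by (simp add: T_def b_def)
  ultimately show ?thesis by (simp add: a_def)
qed

text \<open>
  The Hankel determinant as a polynomial in \<open>x\<close>. It allows the factor \<open>J\<^sub>n(-2 (x - 1))\<close>, which
  may vanish at single points, to be cancelled.
\<close>

definition H_poly :: "nat \<Rightarrow> 'a::field_char_0 poly" where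
  "H_poly n = det (mat (n + 1) (n + 1) (\<lambda>(i, j). \<Sum>m = 0..i + j. monom (of_nat ((3 * (i + j) + 1 - m) choose (i + j - m))) m))"

lemma poly_H_poly: "poly (H_poly n) x = H n x"
proof -
  interpret comm_ring_hom "\<lambda>p. poly p x" by unfold_locales auto
  show ?thesis unfolding H_poly_def H_def hom_det[symmetric]
    by (intro arg_cong[of _ _ det] eq_matI) (auto simp: a_poly_def poly_sum poly_monom)
qed

lemma coeff_jac_top_nz: "coeff (jac n) n \<noteq> (0 :: 'a::field_char_0)"
  unfolding coeff_jac_top jac_coeff_def by (simp del: fact_Suc)

lemma H_eq_jac:
  fixes x :: "'a::field_char_0"
  shows "H n x = (\<Prod>i<n. coeff (jac i) 0 / coeff (jac (Suc i)) (Suc i)) * poly (jac n) (- 2 * (x - 1))"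
proof -
  let ?c = "\<lambda>n. \<Prod>i<n. coeff (jac i) 0 / coeff (jac (Suc i)) (Suc i) :: 'a"
  let ?J = "\<lambda>n. pcompose (jac n) [:2, - 2:] :: 'a poly"
  have J: "poly (?J n) x = poly (jac n) (- 2 * (x - 1))" for n x
    by (simp add: poly_pcompose algebra_simps)
  have "H_poly n = smult (?c n) (?J n)"
  proof (induction n)
    case 0
    show ?case
      unfolding poly_eq_poly_eq_iff[symmetric]
      by (simp add: fun_eq_iff poly_H_poly H_def det_single a_poly_def J poly_jac jac_coeff_def)
  next
    case (Suc n)
    have Jnz: "?J n \<noteq> 0"
    proof -
      have "jac n \<noteq> (0 :: 'a poly)" using coeff_jac_top_nz[of n] by (metis coeff_0)
      then show ?thesis by (simp add: pcompose_eq_0_iff)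
    qed
    show ?case
    proof (rule poly_eqI_off_finite[of "{1} \<union> {x. poly (?J n) x = 0}"])
      show "finite ({1} \<union> {x. poly (?J n) x = 0})" using poly_roots_finite[OF Jnz] by simp
      fix x assume "x \<notin> {1} \<union> {x. poly (?J n) x = 0}"
      then have x: "x \<noteq> 1" "poly (?J n) x \<noteq> 0" by auto
      have Hn: "H n x = ?c n * poly (?J n) x" using arg_cong[OF Suc.IH, of "\<lambda>p. poly p x"] by (simp add: poly_H_poly)
      have "poly (?J n) x * coeff (jac (Suc n)) (Suc n) * H (Suc n) x
          = poly (?J (Suc n)) x * coeff (jac n) 0 * H n x"
        unfolding J by (rule hankel_step[OF x(1)])
      then have "coeff (jac (Suc n)) (Suc n) * H (Suc n) x = poly (?J (Suc n)) x * coeff (jac n) 0 * ?c n"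
        using x(2) unfolding Hn by simp
      then show "poly (H_poly (Suc n)) x = poly (smult (?c (Suc n)) (?J (Suc n))) x"
        using coeff_jac_top_nz[of "Suc n", where 'a = 'a] by (simp add: poly_H_poly field_simps)
    qed
  qed
  from arg_cong[OF this, of "\<lambda>p. poly p x"] show ?thesis by (simp add: poly_H_poly J)
qed


section \<open>The constant factor\<close>

lemma prod_odd_fact:
  "(\<Prod>i<k. of_nat (4 * i + 4 * m + 2)) * (fact (2 * m) * fact (m + k)) = (fact m * fact (2 * (m + k)) :: 'a::field_char_0)"
proof (induction k)
  case 0 then show ?case by simp
next
  case (Suc k)
  have "fact (2 * (m + Suc k)) = (of_nat (2 * (m + Suc k)) * of_nat (2 * (m + k) + 1) * fact (2 * (m + k)) :: 'a)"
    by (simp add: algebra_simps)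
  moreover have "fact (m + Suc k) = (of_nat (m + Suc k) * fact (m + k) :: 'a)" by simp
  moreover have "of_nat (4 * k + 4 * m + 2) = (2 * of_nat (2 * (m + k) + 1) :: 'a)"
    "of_nat (2 * (m + Suc k)) = (2 * of_nat (m + Suc k) :: 'a)" by simp_all
  ultimately show ?case using arg_cong[OF Suc.IH, of "\<lambda>z. 2 * of_nat (2 * (m + k) + 1) * of_nat (m + Suc k) * z"]
    by (simp only: prod.lessThan_Suc mult_ac)
qed

text \<open>
  The leading coefficient of \<open>J\<^sub>n\<close> is known from its expansion at \<open>-4\<close>, and the recurrence of the
  coefficients at \<open>0\<close> relates it to the constant one.
\<close>

lemma coeff_jac_0:
  "coeff (jac n) 0 * (fact (3 * n + 2) * fact (4 * n + 4)) = ((-1) ^ n * (2 * fact (n + 1) * fact (6 * n + 4)) :: 'a::field_char_0)"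
proof -
  define P where "P = (\<Prod>i<n. of_nat (4 * i + 8 * n + 10) :: 'a)"
  define A B C D E F :: 'a where "A = fact (4 * n + 4)" and "B = fact (3 * n + 2)" and "C = fact (2 * n + 1)"
    and "D = fact (6 * n + 4)" and "E = fact (4 * n + 2)" and "F = fact n"
  define s c l :: 'a where "s = (-1) ^ n" and "c = coeff (jac n) 0" and "l = coeff (jac n) n"
  define r :: 'a where "r = of_nat (n + 1)"
  have nz: "E \<noteq> 0" "F \<noteq> 0" "B \<noteq> 0" "C \<noteq> 0" unfolding E_def F_def B_def C_def by (rule fact_nonzero)+
  have ar: "4 * i + 4 * (2 * n + 2) + 2 = 4 * i + 8 * n + 10" "2 * (2 * n + 2) = 4 * n + 4"
     "2 * n + 2 + n = 3 * n + 2" "2 * (3 * n + 2) = 6 * n + 4" "3 * n + n + 2 = 4 * n + 2" for i by simp_all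
  have r2: "fact (2 * n + 2) = 2 * r * C" by (simp add: r_def C_def algebra_simps)
  have r1: "fact (n + 1) = r * F" by (simp add: r_def F_def)
  have P: "P * (A * B) = 2 * r * C * D"
    using prod_odd_fact[where k = n and m = "2 * n + 2" and 'a = 'a]
    unfolding ar r2 P_def[symmetric] A_def[symmetric] B_def[symmetric] D_def[symmetric] .
  have t: "l * (B * C) = s * (F * E)"
    using nz unfolding l_def coeff_jac_top jac_coeff_def ar diff_self_eq_0 B_def[symmetric] C_def[symmetric]
      F_def[symmetric] E_def[symmetric] s_def[symmetric]
    by simp
  have c: "l * (F * B * P) = c * (F * E)"
    using coeff_jac_chain[of n n, where 'a = 'a]
    unfolding l_def c_def ar diff_self_eq_0 B_def[symmetric] F_def[symmetric] E_def[symmetric] P_def[symmetric]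
    by simp
  have "E * (c * (B * A)) * F = B * (P * (A * B)) * l * F"
    using arg_cong[OF c, of "\<lambda>z. z * (B * A)"] by (simp only: mult_ac)
  also have "\<dots> = (l * (B * C)) * (2 * r * D) * F" unfolding P by (simp only: mult_ac)
  also have "\<dots> = E * (s * (2 * (r * F) * D)) * F" unfolding t by (simp only: mult_ac)
  finally have "c * (B * A) = s * (2 * (r * F) * D)" using nz by simp
  then show ?thesis unfolding c_def A_def B_def D_def s_def r1 .
qed

lemma jac_ratio:
  "coeff (jac i) 0 / coeff (jac (Suc i)) (Suc i)
   = - ((fact (6 * i + 3) * fact (3 * i + 5) * fact (2 * i + 1)) /
        (fact (4 * i + 3) * fact (4 * i + 5) * fact (3 * i + 1)) :: 'a::field_char_0)"
proof -
  define A B C D E F G :: 'a where "A = fact (6 * i + 3)" and "B = fact (3 * i + 5)" and "C = fact (2 * i + 1)"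
    and "D = fact (4 * i + 3)" and "E = fact (4 * i + 5)" and "F = fact (3 * i + 1)" and "G = fact (Suc i)"
  define p q r s :: 'a where "p = of_nat (3 * i + 2)" and "q = of_nat (i + 1)" and "r = of_nat (2 * i + 3)"
    and "s = (-1) ^ i"
  have nz: "A \<noteq> 0" "B \<noteq> 0" "C \<noteq> 0" "D \<noteq> 0" "E \<noteq> 0" "F \<noteq> 0" "G \<noteq> 0"
    unfolding A_def B_def C_def D_def E_def F_def G_def by (rule fact_nonzero)+
  have nz2: "p \<noteq> 0" "q \<noteq> 0" "r \<noteq> 0" unfolding p_def q_def r_def of_nat_eq_0_iff by simp_all
  have s: "s * s = 1" by (simp add: s_def flip: power_mult_distrib)
  have f: "fact (3 * i + 2) = p * F" "fact (4 * i + 4) = 4 * q * D" "fact (6 * i + 4) = 2 * p * A"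
    "fact (2 * i + 3) = r * (2 * q) * C" "fact (4 * i + 6) = 2 * r * E" "fact (i + 1) = G"
    by (simp_all add: A_def C_def D_def E_def F_def G_def p_def q_def r_def numeral_eq_Suc algebra_simps)
  have ar: "3 * Suc i + Suc i + 2 = 4 * i + 6" "3 * Suc i + 2 = 3 * i + 5" "2 * Suc i + 1 = 2 * i + 3" by simp_all
  have 1: "coeff (jac i) 0 * (p * F * (4 * q * D)) = s * (2 * G * (2 * p * A))"
    using coeff_jac_0[of i, where 'a = 'a] unfolding f s_def .
  have c0: "coeff (jac i) 0 = s * G * A / (F * q * D)"
  proof -
    have "4 * p * (coeff (jac i) 0 * (F * q * D)) = 4 * p * (s * G * A)" using 1 by (simp add: mult_ac)
    then have "coeff (jac i) 0 * (F * q * D) = s * G * A" using nz2 by simp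
    then show ?thesis using nz nz2 by (simp add: eq_divide_eq)
  qed
  have ct: "coeff (jac (Suc i)) (Suc i) = - (s * (G * (2 * r * E)) / (B * (r * (2 * q) * C)))"
    unfolding coeff_jac_top jac_coeff_def ar f diff_self_eq_0 by (simp add: s_def G_def B_def del: fact_Suc)
  have "s \<noteq> 0" using s by auto
  then show ?thesis
    using nz nz2 unfolding c0 ct A_def[symmetric] B_def[symmetric] C_def[symmetric] D_def[symmetric] E_def[symmetric] F_def[symmetric]
    by (simp add: field_simps)
qed

theorem theorem2:
  fixes n :: nat and x :: "'a::field_char_0"
  shows "H n x =
    (-1) ^ n *
    (\<Prod>i = 1..n. (fact (6 * i - 3) * fact (3 * i + 2) * fact (2 * i - 1)) /
                 (fact (4 * i - 1) * fact (4 * i + 1) * fact (3 * i - 2))) *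
    (\<Sum>i = 0..n. (fact n * fact (3 * n + i + 2) * 2 ^ i * (x - 3) ^ i) /
                 (fact (3 * n + 2) * fact (n - i) * fact (2 * i + 1)))"
proof -
  let ?f = "\<lambda>i. (fact (6 * i - 3) * fact (3 * i + 2) * fact (2 * i - 1)) /
                 (fact (4 * i - 1) * fact (4 * i + 1) * fact (3 * i - 2)) :: 'a"
  have "(\<Prod>i<n. coeff (jac i) 0 / coeff (jac (Suc i)) (Suc i)) = (\<Prod>i<n. - ?f (Suc i))"
  proof (intro prod.cong refl)
    fix i
    have "6 * Suc i - 3 = 6 * i + 3" "3 * Suc i + 2 = 3 * i + 5" "2 * Suc i - 1 = 2 * i + 1"
      "4 * Suc i - 1 = 4 * i + 3" "4 * Suc i + 1 = 4 * i + 5" "3 * Suc i - 2 = 3 * i + 1" by simp_all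
    then show "coeff (jac i) 0 / coeff (jac (Suc i)) (Suc i) = - ?f (Suc i)"
      by (simp only: jac_ratio)
  qed
  also have "\<dots> = (-1) ^ n * (\<Prod>i<n. ?f (Suc i))"
    by (simp only: prod_uminus card_lessThan)
  also have "(\<Prod>i<n. ?f (Suc i)) = (\<Prod>i = 1..n. ?f i)"
    by (simp only: One_nat_def prod.atLeast1_atMost_eq)
  finally have prod: "(\<Prod>i<n. coeff (jac i) 0 / coeff (jac (Suc i)) (Suc i)) = (-1) ^ n * (\<Prod>i = 1..n. ?f i)" .
  have "poly (jac n) (- 2 * (x - 1)) = (\<Sum>i\<le>n. jac_coeff n i * (- 2 * (x - 3)) ^ i)"
    unfolding poly_jac by (simp add: algebra_simps)
  also have "\<dots> = (\<Sum>i = 0..n. (fact n * fact (3 * n + i + 2) * 2 ^ i * (x - 3) ^ i) /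
                 (fact (3 * n + 2) * fact (n - i) * fact (2 * i + 1)))"
    unfolding atLeast0AtMost
  proof (intro sum.cong refl)
    fix i assume i: "i \<in> {..n}"
    have "(- 2 * (x - 3)) ^ i = (-1) ^ i * (2 ^ i * (x - 3) ^ i)"
      by (simp add: power_mult_distrib[symmetric])
    moreover have "(-1) ^ i * (-1) ^ i = (1 :: 'a)" by (simp flip: power_mult_distrib)
    ultimately show "jac_coeff n i * (- 2 * (x - 3)) ^ i = (fact n * fact (3 * n + i + 2) * 2 ^ i * (x - 3) ^ i) /
                 (fact (3 * n + 2) * fact (n - i) * fact (2 * i + 1))"
      using i by (simp add: jac_coeff_def mult_ac del: fact_Suc)
  qed
  finally show ?thesis unfolding H_eq_jac prod by simp
qed

end
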